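(* Let $M\ge 2$ and $n\ge 1$. Observe $\mathbf{y}=\mathbf{f}+\boldsymbol{\xi}\in\mathbf{R}^n$, where $\mathbf{f}\in\mathbf{R}^n$ is unknown and $\xi_1,\dots,\xi_n$ are i.i.d. $\mathcal N(0,\sigma^2)$. For $j=1,\dots,M$ let $\hat{\boldsymbol\mu}_j=A_j\mathbf{y}+\mathbf{b}_j$, where $A_j$ is a deterministic $n\times n$ real matrix with $\|A_j\|_{op}\le 1$ and $\mathbf{b}_j\in\mathbf{R}^n$ is deterministic. Let $\hat{\boldsymbol\theta}_{\mathrm{pen}}\in\arg\min_{\boldsymbol\theta\in\Lambda^M}H_{\mathrm{pen}}(\boldsymbol\theta)$. Then for all $x>0$, with probability at least $1-2e^{-x}$, \[\|\hat{\boldsymbol\mu}_{\hat{\boldsymbol\theta}_{\mathrm{pen}}}-\mathbf f\|_2^2\le \min_{j=1,\dots,M}\|\hat{\boldsymbol\mu}_j-\mathbf f\|_2^2+46\sigma^2(2\log M+x).\] Furthermore, \[\mathbb E\|\hat{\boldsymbol\mu}_{\hat{\boldsymbol\theta}_{\mathrm{pen}}}-\mathbf f\|_2^2\le \mathbb E\Big[\min_{j=1,\dots,M}\|\hat{\boldsymbol\mu}_j-\mathbf f\|_2^2\Big]+92\sigma^2\log(eM).\]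
   Context: $\|\cdot\|_2$ is the Euclidean norm, $\|\cdot\|_{op}$ the operator norm, $\log$ the natural logarithm. $\Lambda^M=\{\boldsymbol\theta\in\mathbf R^M:\sum_j\theta_j=1,\ \theta_j\ge0\}$. For $\boldsymbol\theta\in\Lambda^M$: $A_{\boldsymbol\theta}=\sum_j\theta_jA_j$, $\mathbf b_{\boldsymbol\theta}=\sum_j\theta_j\mathbf b_j$, $\hat{\boldsymbol\mu}_{\boldsymbol\theta}=A_{\boldsymbol\theta}\mathbf y+\mathbf b_{\boldsymbol\theta}$. Mallows' criterion $C_p(\boldsymbol\theta)=\|\hat{\boldsymbol\mu}_{\boldsymbol\theta}\|_2^2-2\mathbf y^T\hat{\boldsymbol\mu}_{\boldsymbol\theta}+2\sigma^2\mathrm{Tr}(A_{\boldsymbol\theta})$, penalty $\mathrm{pen}(\boldsymbol\theta)=\sum_{j=1}^M\theta_j\|\hat{\boldsymbol\mu}_{\boldsymbol\theta}-\hat{\boldsymbol\mu}_j\|_2^2$, and $H_{\mathrm{pen}}(\boldsymbol\theta)=C_p(\boldsymbol\theta)+\tfrac12\mathrm{pen}(\boldsymbol\theta)$. *)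

theory Defs
  imports "HOL-Analysis.Analysis" "HOL-Probability.Probability"
begin

text \<open>Simplex Lambda^M, indexed by a finite type 'm with CARD('m) = M.\<close>
definition prob_simplex :: "(real ^ 'm::finite) set" where
  "prob_simplex = {\<theta>. (\<forall>j. 0 \<le> \<theta> $ j) \<and> (\<Sum>j\<in>UNIV. \<theta> $ j) = 1}"

definition mat_trace :: "real ^ 'n ^ 'n \<Rightarrow> real" where
  "mat_trace A = (\<Sum>i\<in>UNIV. A $ i $ i)"

definition A_mix :: "('m::finite \<Rightarrow> real ^ 'n ^ 'n) \<Rightarrow> real ^ 'm \<Rightarrow> real ^ 'n ^ 'n" where
  "A_mix A \<theta> = (\<Sum>j\<in>UNIV. (\<theta> $ j) *\<^sub>R A j)"

definition b_mix :: "('m::finite \<Rightarrow> real ^ 'n) \<Rightarrow> real ^ 'm \<Rightarrow> real ^ 'n" where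
  "b_mix b \<theta> = (\<Sum>j\<in>UNIV. (\<theta> $ j) *\<^sub>R b j)"

definition mu_j :: "('m \<Rightarrow> real ^ 'n ^ 'n) \<Rightarrow> ('m \<Rightarrow> real ^ 'n) \<Rightarrow> 'm \<Rightarrow> real ^ 'n \<Rightarrow> real ^ 'n" where
  "mu_j A b j y = A j *v y + b j"

definition mu_mix :: "('m::finite \<Rightarrow> real ^ 'n ^ 'n) \<Rightarrow> ('m \<Rightarrow> real ^ 'n) \<Rightarrow> real ^ 'm \<Rightarrow> real ^ 'n \<Rightarrow> real ^ 'n" where
  "mu_mix A b \<theta> y = A_mix A \<theta> *v y + b_mix b \<theta>"

definition Cp :: "real \<Rightarrow> ('m::finite \<Rightarrow> real ^ 'n ^ 'n) \<Rightarrow> ('m \<Rightarrow> real ^ 'n) \<Rightarrow> real ^ 'n \<Rightarrow> real ^ 'm \<Rightarrow> real" where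
  "Cp \<sigma> A b y \<theta> = (norm (mu_mix A b \<theta> y))\<^sup>2 - 2 * (y \<bullet> mu_mix A b \<theta> y) + 2 * \<sigma>\<^sup>2 * mat_trace (A_mix A \<theta>)"

definition pen :: "('m::finite \<Rightarrow> real ^ 'n ^ 'n) \<Rightarrow> ('m \<Rightarrow> real ^ 'n) \<Rightarrow> real ^ 'n \<Rightarrow> real ^ 'm \<Rightarrow> real" where
  "pen A b y \<theta> = (\<Sum>j\<in>UNIV. \<theta> $ j * (norm (mu_mix A b \<theta> y - mu_j A b j y))\<^sup>2)"

definition H_pen :: "real \<Rightarrow> ('m::finite \<Rightarrow> real ^ 'n ^ 'n) \<Rightarrow> ('m \<Rightarrow> real ^ 'n) \<Rightarrow> real ^ 'n \<Rightarrow> real ^ 'm \<Rightarrow> real" where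
  "H_pen \<sigma> A b y \<theta> = Cp \<sigma> A b y \<theta> + pen A b y \<theta> / 2"

end

theory Submission
  imports Defs
begin

text \<open>
  On the simplex \<open>H_pen\<close> is half the squared norm of the aggregate plus a linear function, so first-order
  optimality at \<open>\<theta>hat\<close> bounds the excess loss over the \<open>k\<close>-th estimator by a \<open>\<theta>hat\<close>-average over \<open>j\<close> of
  \<open>Z j k = 2 \<xi> \<bullet> g - 2 \<sigma>\<^sup>2 tr B - |g|\<^sup>2 / 2\<close> with \<open>B = A j - A k\<close> and \<open>g = B \<xi> + v\<close> affine in the noise.
  It remains to show \<open>E exp (Z j k / (46 \<sigma>\<^sup>2)) \<le> 1\<close>: Markov's and Jensen's inequalities for the sum over
  all pairs then give both claims.  For this, \<open>exp (Z / (46 \<sigma>\<^sup>2))\<close> is dominated by a constant times the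
  ratio of the Gaussian density at \<open>T \<xi>\<close> and at \<open>\<xi>\<close>, where \<open>T x = x - s g + k B\<^sup>T (g + v)\<close>.  The expectation of
  the ratio is the Jacobian factor of \<open>T\<close>, and the term \<open>k B\<^sup>T B\<close> in its linear part outweighs the second-order
  part of the Jacobian.
\<close>

section \<open>Frobenius norm estimates\<close>

lemma inner_matrix_vector_transpose:
  fixes A :: "real^'n^'m"
  shows "x \<bullet> (A *v y) = (transpose A *v x) \<bullet> y"
  by (simp add: dot_lmul_matrix)

text \<open>When \<open>transpose A *v x\<close> is nonzero, its squared norm equals
  \<open>x \<bullet> (A *v (transpose A *v x))\<close>, and one factor cancels after Cauchy-Schwarz.
  Operator bounds thus pass to transposes.\<close>

lemma norm_transpose_mult_le:
  fixes A :: "real^'n^'m"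
  assumes "\<And>x. norm (A *v x) \<le> c * norm x"
  shows "norm (transpose A *v x) \<le> c * norm x"
proof (cases "transpose A *v x = 0")
  case True
  have "0 \<le> c * norm x"
  proof (cases "x = 0")
    case False
    \<comment> \<open>The hypothesis at a unit vector fixes the sign of \<open>c\<close>.\<close>
    have "0 \<le> c * norm (axis undefined 1 :: real^'n)"
      using assms order_trans norm_ge_zero by blast
    then show ?thesis by (simp)
  qed simp
  then show ?thesis using True by simp
next
  case False
  have "(norm (transpose A *v x))\<^sup>2 = x \<bullet> (A *v (transpose A *v x))"
    by (simp add: inner_matrix_vector_transpose power2_norm_eq_inner)
  also have "\<dots> \<le> norm x * norm (A *v (transpose A *v x))"
    by (rule norm_cauchy_schwarz)
  also have "\<dots> \<le> norm x * (c * norm (transpose A *v x))"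
    by (intro mult_left_mono assms) auto
  finally show ?thesis using False by (simp add: power2_eq_square mult_ac)
qed

lemma norm_transpose_matrix:
  fixes A :: "real^'n^'m"
  shows "norm (transpose A) = norm A"
proof -
  have "(norm (transpose A))\<^sup>2 = (norm A)\<^sup>2"
    unfolding power2_norm_eq_inner inner_vec_def transpose_def
    by (simp, rule sum.swap)
  then show ?thesis by simp
qed

text \<open>\<open>norm\<close> on matrices is the Frobenius norm, the \<open>L2_set\<close> of the
  column norms, and the columns of \<open>A ** C\<close> are the images under \<open>A\<close> of
  the columns of \<open>C\<close>.\<close>

lemma norm_matrix_mult_le:
  fixes A :: "real^'n^'m" and C :: "real^'k^'n"
  assumes "\<And>x. norm (A *v x) \<le> c * norm x" and "0 \<le> c"
  shows "norm (A ** C) \<le> c * norm C"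
proof -
  have col: "(transpose (A ** C)) $ k = A *v (transpose C $ k)" for k
    by (vector transpose_def matrix_matrix_mult_def matrix_vector_mult_def)
  have "norm (A ** C) = L2_set (\<lambda>k. norm (A *v (transpose C $ k))) UNIV"
    unfolding norm_transpose_matrix[of "A ** C", symmetric] norm_vec_def[of "transpose (A ** C)"] col ..
  also have "\<dots> \<le> L2_set (\<lambda>k. c * norm (transpose C $ k)) UNIV"
    by (intro L2_set_mono assms) auto
  also have "\<dots> = c * norm (transpose C)"
    using \<open>0 \<le> c\<close> by (simp add: L2_set_right_distrib norm_vec_def[of "transpose C"])
  finally show ?thesis by (simp add: norm_transpose_matrix)
qed

text \<open>As a Frobenius inner product the trace inherits linearity from
  \<open>inner\<close>.\<close>

lemma mat_trace_eq_inner: "mat_trace A = mat 1 \<bullet> A"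
  unfolding mat_trace_def inner_vec_def mat_def
  by (simp add: if_distrib[where f="\<lambda>z. z * _"] cong: if_cong)

lemma mat_trace_mult: "mat_trace (A ** C) = transpose A \<bullet> C"
  unfolding mat_trace_def inner_vec_def transpose_def matrix_matrix_mult_def
  by (simp, rule sum.swap)

lemma norm_mat_1: "(norm (mat 1 :: real^'n^'n))\<^sup>2 = CARD('n)"
  unfolding power2_norm_eq_inner mat_trace_eq_inner[symmetric]
  by (simp add: mat_trace_def mat_def)

lemma matrix_mult_diff_rdistrib:
  fixes A B :: "real^'n^'m"
  shows "(A - B) ** C = A ** C - B ** C"
  by (simp add: matrix_matrix_mult_def vec_eq_iff left_diff_distrib sum_subtractf)

text \<open>The operator bound \<open>r < 1\<close> makes the kernel trivial. Instead of a Neumann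
  series, the fixed-point equation \<open>Y = X + X ** Y\<close> for \<open>L = mat 1 + Y\<close>
  bounds \<open>norm Y\<close> by \<open>norm X / (1 - r)\<close> and the trace of \<open>Y\<close>
  by that of \<open>X\<close> plus a multiple of \<open>(norm X)\<^sup>2\<close>; the square of
  \<open>norm L\<close> expands into these.\<close>

lemma mat_1_minus_inverse:
  fixes X :: "real^'n^'n"
  assumes X: "\<And>x. norm (X *v x) \<le> r * norm x" and r: "0 \<le> r" "r < 1"
  obtains L where "(mat 1 - X) ** L = mat 1" "L ** (mat 1 - X) = mat 1"
    "(norm L)\<^sup>2 \<le> CARD('n) + 2 * mat_trace X + (2 / (1 - r) + 1 / (1 - r)\<^sup>2) * (norm X)\<^sup>2"
proof -
  have "x = 0" if "(mat 1 - X) *v x = 0" for x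
  proof -
    have "x = X *v x" using that by (simp add: matrix_vector_mult_diff_rdistrib)
    then have "norm x \<le> r * norm x" using X[of x] by simp
    then have "(1 - r) * norm x \<le> 0" by (simp add: algebra_simps)
    then show ?thesis using r by (simp add: mult_le_0_iff)
  qed
  then obtain L where L: "L ** (mat 1 - X) = mat 1"
    using matrix_left_invertible_ker[of "mat 1 - X"] by auto
  then have R: "(mat 1 - X) ** L = mat 1" by (simp add: matrix_left_right_inverse)
  define Y where "Y = X ** L"
  have LY: "L = mat 1 + Y"
    using R unfolding Y_def by (simp add: matrix_mult_diff_rdistrib algebra_simps)
  have Y: "Y = X + X ** Y"
    by (subst Y_def, subst LY, simp add: matrix_add_ldistrib)
  have "norm Y \<le> norm X + norm (X ** Y)"
    by (subst Y) (rule norm_triangle_ineq)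
  also have "\<dots> \<le> norm X + r * norm Y"
    using norm_matrix_mult_le[OF X r(1)] by simp
  finally have "(1 - r) * norm Y \<le> norm X" by (simp add: algebra_simps)
  then have nY: "norm Y \<le> norm X / (1 - r)" using r by (simp add: field_simps)
  have "mat_trace Y = mat_trace X + mat_trace (X ** Y)"
    by (subst Y) (simp add: mat_trace_eq_inner inner_add_right)
  also have "mat_trace (X ** Y) \<le> norm X * norm Y"
    unfolding mat_trace_mult using norm_cauchy_schwarz[of "transpose X" Y] by (simp add: norm_transpose_matrix)
  also have "\<dots> \<le> norm X * (norm X / (1 - r))" by (intro mult_left_mono nY) auto
  finally have tY: "mat_trace Y \<le> mat_trace X + (norm X)\<^sup>2 / (1 - r)" by (simp add: power2_eq_square)
  have "(norm Y)\<^sup>2 \<le> (norm X / (1 - r))\<^sup>2" by (intro power_mono nY) auto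
  moreover have "(norm L)\<^sup>2 = CARD('n) + 2 * mat_trace Y + (norm Y)\<^sup>2"
    unfolding LY mat_trace_eq_inner norm_mat_1[symmetric] power2_norm_eq_inner
    by (simp add: inner_add_left inner_add_right inner_commute)
  ultimately have "(norm L)\<^sup>2 \<le> CARD('n) + 2 * mat_trace X + (2 / (1 - r) + 1 / (1 - r)\<^sup>2) * (norm X)\<^sup>2"
    using tY by (simp add: power_divide algebra_simps)
  with L R show ?thesis using that by blast
qed

section \<open>Linear images of Lebesgue measure\<close>

lemma nn_integral_lborel_shift:
  fixes c :: "'a::euclidean_space"
  assumes [measurable]: "F \<in> borel_measurable borel"
  shows "(\<integral>\<^sup>+x. F (x + c) \<partial>lborel) = (\<integral>\<^sup>+x. F x \<partial>lborel)"
proof -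
  have "(\<integral>\<^sup>+x. F x \<partial>lborel) = (\<integral>\<^sup>+x. F x \<partial>distr lborel borel ((+) c))"
    by (simp add: lborel_distr_plus)
  also have "\<dots> = (\<integral>\<^sup>+x. F (c + x) \<partial>lborel)"
    by (simp add: nn_integral_distr)
  finally show ?thesis by (simp add: add.commute)
qed

text \<open>
  Uniqueness of translation-invariant measures identifies the scaling factor of a linear
  bijection without determinants: integrate \<open>F (K x) * p y\<close> over both variables and shift them
  in turn.
\<close>

lemma nn_integral_lborel_linear:
  fixes K L :: "'a::euclidean_space \<Rightarrow> 'a" and p F :: "'a \<Rightarrow> ennreal"
  assumes K: "linear K" and KL: "\<And>x. K (L x) = x"
    and [measurable]: "F \<in> borel_measurable borel" "p \<in> borel_measurable borel"
    and even: "\<And>x. p (- x) = p x" and p1: "(\<integral>\<^sup>+x. p x \<partial>lborel) = 1"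
  shows "(\<integral>\<^sup>+x. F (K x) \<partial>lborel) = (\<integral>\<^sup>+x. p (K x) \<partial>lborel) * (\<integral>\<^sup>+x. F x \<partial>lborel)"
proof -
  have [measurable]: "K \<in> borel_measurable borel"
    using K by (intro borel_measurable_continuous_onI linear_continuous_on) (simp add: linear_conv_bounded_linear)
  \<comment> \<open>Moving \<open>x\<close> by \<open>L y\<close> moves \<open>K x\<close> by
    \<open>y\<close>, so translation invariance acts on the image variable.\<close>
  have shift: "(\<integral>\<^sup>+x. G (K x + y) \<partial>lborel) = (\<integral>\<^sup>+x. G (K x) \<partial>lborel)"
    if [measurable]: "G \<in> borel_measurable borel" for G :: "'a \<Rightarrow> ennreal" and y
    using nn_integral_lborel_shift[of "\<lambda>x. G (K x)" "L y"] by (simp add: linear_add[OF K] KL)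
  have "(\<integral>\<^sup>+x. F (K x) \<partial>lborel) = (\<integral>\<^sup>+y. p y * (\<integral>\<^sup>+x. F (K x) \<partial>lborel) \<partial>lborel)"
    by (simp add: nn_integral_multc p1)
  also have "\<dots> = (\<integral>\<^sup>+y. (\<integral>\<^sup>+x. p y * F (K x + y) \<partial>lborel) \<partial>lborel)"
    by (simp add: nn_integral_cmult shift)
  also have "\<dots> = (\<integral>\<^sup>+x. (\<integral>\<^sup>+y. p y * F (K x + y) \<partial>lborel) \<partial>lborel)"
    by (rule lborel_pair.Fubini') simp
  also have "\<dots> = (\<integral>\<^sup>+x. (\<integral>\<^sup>+y. p (y - K x) * F y \<partial>lborel) \<partial>lborel)"
  proof (rule nn_integral_cong)
    fix x :: 'a
    show "(\<integral>\<^sup>+y. p y * F (K x + y) \<partial>lborel) = (\<integral>\<^sup>+y. p (y - K x) * F y \<partial>lborel)"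
      using nn_integral_lborel_shift[of "\<lambda>y. p (y - K x) * F y" "K x"] by (simp add: add.commute)
  qed
  also have "\<dots> = (\<integral>\<^sup>+y. (\<integral>\<^sup>+x. p (y - K x) * F y \<partial>lborel) \<partial>lborel)"
    by (rule lborel_pair.Fubini'[symmetric]) simp
  also have "\<dots> = (\<integral>\<^sup>+y. (\<integral>\<^sup>+x. p (K x) \<partial>lborel) * F y \<partial>lborel)"
  proof (rule nn_integral_cong)
    \<comment> \<open>Evenness turns \<open>p (y - K x)\<close> into \<open>p (K x - y)\<close>,
      where \<open>shift\<close> removes the \<open>- y\<close>.\<close>
    fix y :: 'a
    have "(\<integral>\<^sup>+x. p (y - K x) * F y \<partial>lborel) = (\<integral>\<^sup>+x. p (K x + - y) \<partial>lborel) * F y"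
      using even[of "_ - _"] by (simp add: nn_integral_multc)
    then show "(\<integral>\<^sup>+x. p (y - K x) * F y \<partial>lborel) = (\<integral>\<^sup>+x. p (K x) \<partial>lborel) * F y"
      by (simp add: shift del: add_uminus_conv_diff)
  qed
  finally show ?thesis by (simp add: nn_integral_cmult)
qed

section \<open>Gaussian vectors\<close>

text \<open>The product form matches independent coordinates; \<open>gaussian_density_exp\<close>
  supplies the radial form, from which density ratios are read off.\<close>

definition gaussian_density :: "real \<Rightarrow> real^'n \<Rightarrow> real" where
  "gaussian_density \<sigma> x = (\<Prod>i\<in>UNIV. normal_density 0 \<sigma> (x $ i))"

lemma gaussian_density_exp:
  fixes x :: "real^'n"
  shows "gaussian_density \<sigma> x = (1 / sqrt (2 * pi * \<sigma>\<^sup>2)) ^ CARD('n) * exp (- (norm x)\<^sup>2 / (2 * \<sigma>\<^sup>2))"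
proof -
  have "gaussian_density \<sigma> x = (\<Prod>i\<in>(UNIV::'n set). 1 / sqrt (2 * pi * \<sigma>\<^sup>2)) * (\<Prod>i\<in>UNIV. exp (- (x $ i)\<^sup>2 / (2 * \<sigma>\<^sup>2)))"
    unfolding gaussian_density_def normal_density_def prod.distrib by simp
  also have "(\<Prod>i\<in>UNIV. exp (- (x $ i)\<^sup>2 / (2 * \<sigma>\<^sup>2))) = exp (\<Sum>i\<in>UNIV. - (x $ i)\<^sup>2 / (2 * \<sigma>\<^sup>2))"
    by (simp add: exp_sum)
  also have "(\<Sum>i\<in>UNIV. - (x $ i)\<^sup>2 / (2 * \<sigma>\<^sup>2)) = - (norm x)\<^sup>2 / (2 * \<sigma>\<^sup>2)"
    unfolding power2_norm_eq_inner inner_vec_def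
    by (simp add: sum_divide_distrib sum_negf power2_eq_square)
  finally show ?thesis by simp
qed

lemma gaussian_density_nonneg [simp]: "0 \<le> gaussian_density \<sigma> x"
  by (simp add: gaussian_density_def prod_nonneg)

lemma gaussian_density_uminus: "gaussian_density \<sigma> (- x) = gaussian_density \<sigma> x"
  by (simp add: gaussian_density_exp)

lemma borel_measurable_gaussian_density [measurable]: "gaussian_density \<sigma> \<in> borel_measurable borel"
  unfolding gaussian_density_exp[abs_def] by measurable

lemma borel_measurable_matrix_vector_mult [measurable (raw)]:
  fixes A :: "real^'n^'m"
  assumes "g \<in> borel_measurable M"
  shows "(\<lambda>x. A *v g x) \<in> borel_measurable M"
  using assms by (rule borel_measurable_continuous_on[OF matrix_vector_mult_linear_continuous_on])

lemma borel_measurable_vec_lambda: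
  fixes g :: "'i::finite \<Rightarrow> 'a \<Rightarrow> real"
  assumes "\<And>i. g i \<in> borel_measurable M"
  shows "(\<lambda>x. \<chi> i. g i x) \<in> borel_measurable M"
  using assms by (subst borel_measurable_iff_halfspace_ge) (auto simp: Basis_vec_def inner_axis)

text \<open>\<open>ennreal\<close> sends negative values to 0, so the right side integrates the
  positive part. This is needed for a tangent line to \<open>exp\<close>, which takes both
  signs.\<close>

lemma integral_le_nn_integral:
  assumes "integrable M (f :: 'a \<Rightarrow> real)"
  shows "ennreal (\<integral>x. f x \<partial>M) \<le> (\<integral>\<^sup>+x. ennreal (f x) \<partial>M)"
proof -
  have "ennreal (\<integral>x. f x \<partial>M) \<le> ennreal (\<integral>x. max 0 (f x) \<partial>M)"
    using assms by (intro ennreal_leI integral_mono) auto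
  also have "\<dots> = (\<integral>\<^sup>+x. ennreal (max 0 (f x)) \<partial>M)"
    using assms by (intro nn_integral_eq_integral[symmetric]) auto
  finally show ?thesis by (simp add: ennreal_max_0)
qed

locale iid_gaussian = prob_space P for P :: "'a measure" +
  fixes \<xi> :: "'n::finite \<Rightarrow> 'a \<Rightarrow> real" and \<sigma> :: real
  assumes sigma_pos: "0 < \<sigma>"
    and indep: "indep_vars (\<lambda>_. borel) \<xi> UNIV"
    and gauss: "\<And>i. distributed P lborel (\<xi> i) (normal_density 0 \<sigma>)"
begin

definition noise :: "'a \<Rightarrow> real^'n" where
  "noise \<omega> = (\<chi> i. \<xi> i \<omega>)"

lemma noise_nth [simp]: "noise \<omega> $ i = \<xi> i \<omega>"
  by (simp add: noise_def)

lemma measurable_xi [measurable]: "\<xi> i \<in> borel_measurable P"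
  using gauss[of i] by (auto simp: distributed_def)

lemma measurable_noise [measurable]: "noise \<in> borel_measurable P"
  unfolding noise_def[abs_def] by (rule borel_measurable_vec_lambda) measurable

text \<open>Open boxes form an intersection-stable generator. On a box the law factors by
  independence, and the density integral factors over coordinates.\<close>

lemma distributed_noise: "distributed P lborel noise (gaussian_density \<sigma>)"
proof -
  have "distr P borel noise = density lborel (gaussian_density \<sigma>)" (is "?M = ?N")
  proof (rule measure_eqI_generator_eq)
    let ?E = "range (\<lambda>(a, b). box a b :: (real^'n) set)"
    show "Int_stable ?E"
      by (auto simp: Int_stable_def box_Int_box)
    show "?E \<subseteq> Pow UNIV" "sets ?M = sigma_sets UNIV ?E" "sets ?N = sigma_sets UNIV ?E"
      by (simp_all add: borel_eq_box)
    let ?A = "\<lambda>n::nat. box (- (real n *\<^sub>R One)) (real n *\<^sub>R One) :: (real^'n) set"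
    show "range ?A \<subseteq> ?E" "(\<Union>i. ?A i) = UNIV"
      unfolding UN_box_eq_UNIV by auto
    show "emeasure ?M (?A i) \<noteq> \<infinity>" for i
      by (simp add: emeasure_distr)
    show "emeasure ?M X = emeasure ?N X" if XE: "X \<in> ?E" for X
    proof -
      obtain a b where X: "X = box a b" using XE by auto
      let ?I = "\<lambda>i. {a $ i <..< b $ i}"
      have X': "X = {x. \<forall>i. x $ i \<in> ?I i}" unfolding X by (auto simp: mem_box_cart)
      have "emeasure ?M X = emeasure P (noise -` X \<inter> space P)"
        by (rule emeasure_distr) (auto simp: X)
      also have "noise -` X \<inter> space P = (\<Inter>i\<in>UNIV. \<xi> i -` ?I i \<inter> space P)"
        unfolding X' by auto
      also have "emeasure P \<dots> = ennreal (\<Prod>i\<in>UNIV. prob (\<xi> i -` ?I i \<inter> space P))"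
        unfolding emeasure_eq_measure by (subst indep_varsD_finite[OF indep]) auto
      also have "\<dots> = (\<Prod>i\<in>UNIV. emeasure P (\<xi> i -` ?I i \<inter> space P))"
        by (simp add: emeasure_eq_measure prod_ennreal)
      also have "\<dots> = (\<Prod>i\<in>UNIV. (\<integral>\<^sup>+x. ennreal (normal_density 0 \<sigma> x) * indicator (?I i) x \<partial>lborel))"
        by (intro prod.cong distributed_emeasure gauss) auto
      \<comment> \<open>The product formula for \<open>lborel\<close> runs over
        \<open>Basis\<close>, so coordinates are reindexed by their unit vectors.\<close>
      also have "\<dots> = (\<Prod>c\<in>(Basis::(real^'n) set).
          (\<integral>\<^sup>+x. ennreal (normal_density 0 \<sigma> x) * indicator {a \<bullet> c <..< b \<bullet> c} x \<partial>lborel))"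
        by (intro prod.reindex_bij_witness[of _ "\<lambda>c. THE i. c = axis i 1" "\<lambda>i. axis i 1"])
           (auto simp: Basis_vec_def inner_axis axis_eq_axis)
      also have "\<dots> = (\<integral>\<^sup>+x. (\<Prod>c\<in>(Basis::(real^'n) set).
          ennreal (normal_density 0 \<sigma> (x \<bullet> c)) * indicator {a \<bullet> c <..< b \<bullet> c} (x \<bullet> c)) \<partial>lborel)"
        by (rule nn_integral_lborel_prod[symmetric]) auto
      also have "\<dots> = (\<integral>\<^sup>+x. ennreal (gaussian_density \<sigma> x) * indicator X x \<partial>lborel)"
      proof (rule nn_integral_cong)
        fix x :: "real^'n"
        have "(\<Prod>c\<in>(Basis::(real^'n) set).
          ennreal (normal_density 0 \<sigma> (x \<bullet> c)) * indicator {a \<bullet> c <..< b \<bullet> c} (x \<bullet> c)) =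
          (\<Prod>i\<in>UNIV. ennreal (normal_density 0 \<sigma> (x $ i)) * indicator (?I i) (x $ i))"
          by (intro prod.reindex_bij_witness[of _ "\<lambda>i. axis i 1" "\<lambda>c. THE i. c = axis i 1"])
            (auto simp: Basis_vec_def inner_axis axis_eq_axis)
        also have "\<dots> = ennreal (gaussian_density \<sigma> x) * (\<Prod>i\<in>UNIV. indicator (?I i) (x $ i))"
          by (simp add: prod.distrib gaussian_density_def prod_ennreal)
        also have "(\<Prod>i\<in>UNIV. indicator (?I i) (x $ i)) = (indicator X x :: ennreal)"
          unfolding X' by (auto simp: indicator_def prod_eq_1_iff intro!: prod_zero)
        finally show "(\<Prod>c\<in>(Basis::(real^'n) set).
          ennreal (normal_density 0 \<sigma> (x \<bullet> c)) * indicator {a \<bullet> c <..< b \<bullet> c} (x \<bullet> c)) =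
          ennreal (gaussian_density \<sigma> x) * indicator X x" .
      qed
      also have "\<dots> = emeasure ?N X"
        by (rule emeasure_density[symmetric]) (auto simp: X)
      finally show ?thesis .
    qed
  qed
  moreover have "distr P lborel noise = distr P borel noise"
    by (rule distr_cong) auto
  ultimately show ?thesis unfolding distributed_def by simp
qed

lemma nn_integral_gaussian_density: "(\<integral>\<^sup>+x. gaussian_density \<sigma> (x :: real^'n) \<partial>lborel) = 1"
  using distributed_nn_integral[OF distributed_noise, of "\<lambda>_. 1"] by (simp add: emeasure_space_1)

lemma integrable_xi: "integrable P (\<xi> i)"
  using integrable_normal_moment_nz_1[OF sigma_pos, of 0]
  by (intro distributed_integrable_var[OF gauss]) auto

lemma has_bochner_integral_xi_sq: "has_bochner_integral P (\<lambda>\<omega>. (\<xi> i \<omega>)\<^sup>2) (\<sigma>\<^sup>2)"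
proof -
  have "has_bochner_integral lborel (\<lambda>x. normal_density 0 \<sigma> x * x\<^sup>2) (\<sigma>\<^sup>2)"
    using normal_moment_even[OF sigma_pos, of 0 1] sigma_pos by (simp add: field_simps power2_eq_square)
  then show ?thesis
    using distributed_integrable[OF gauss[of i], of "\<lambda>x. x\<^sup>2"] distributed_integral[OF gauss[of i], of "\<lambda>x. x\<^sup>2"]
    by (simp add: has_bochner_integral_iff)
qed

lemma has_bochner_integral_xi_prod:
  "has_bochner_integral P (\<lambda>\<omega>. \<xi> i \<omega> * \<xi> j \<omega>) (if i = j then \<sigma>\<^sup>2 else 0)"
proof (cases "i = j")
  case True
  then show ?thesis using has_bochner_integral_xi_sq[of i] by (simp add: power2_eq_square)
next
  case False
  have ind: "indep_vars (\<lambda>_. borel) \<xi> {i, j}"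
    by (rule indep_vars_subset[OF indep]) auto
  have "expectation (\<xi> i) = 0" for i
    by (rule normal_distributed_expectation[OF sigma_pos gauss])
  then show ?thesis
    using False indep_vars_integrable[OF _ ind] indep_vars_lebesgue_integral[OF _ ind] integrable_xi
    by (simp add: has_bochner_integral_iff)
qed

text \<open>Expanding in coordinates, only the diagonal covariances survive, and the squared entries
  of \<open>L\<close> add up to its squared Frobenius norm.\<close>

lemma has_bochner_integral_norm_noise_sq:
  fixes L :: "real^'n^'m"
  shows "has_bochner_integral P (\<lambda>\<omega>. (norm (L *v noise \<omega>))\<^sup>2) (\<sigma>\<^sup>2 * (norm L)\<^sup>2)"
proof -
  have "has_bochner_integral P (\<lambda>\<omega>. \<Sum>i\<in>UNIV. \<Sum>j\<in>UNIV. \<Sum>k\<in>UNIV. (L$i$j * L$i$k) * (\<xi> j \<omega> * \<xi> k \<omega>))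
     (\<Sum>i\<in>UNIV. \<Sum>j\<in>UNIV. \<Sum>k\<in>UNIV. (L$i$j * L$i$k) * (if j = k then \<sigma>\<^sup>2 else 0))"
    by (intro has_bochner_integral_sum has_bochner_integral_mult_right has_bochner_integral_xi_prod)
  moreover have "(norm (L *v noise \<omega>))\<^sup>2 = (\<Sum>i\<in>UNIV. \<Sum>j\<in>UNIV. \<Sum>k\<in>UNIV. (L$i$j * L$i$k) * (\<xi> j \<omega> * \<xi> k \<omega>))" for \<omega>
    unfolding power2_norm_eq_inner inner_vec_def matrix_vector_mult_def
    by (simp add: sum_product mult_ac)
  moreover have "(\<Sum>i\<in>UNIV. \<Sum>j\<in>UNIV. \<Sum>k\<in>UNIV. (L$i$j * L$i$k) * (if j = k then \<sigma>\<^sup>2 else 0)) = \<sigma>\<^sup>2 * (norm L)\<^sup>2"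
    unfolding power2_norm_eq_inner inner_vec_def
    by (simp add: sum_distrib_left mult_ac if_distrib[where f="\<lambda>z. _ * z"] cong: if_cong)
  ultimately show ?thesis by simp
qed

text \<open>The normalizing constants agree, so the exponential is the ratio of the density at
  \<open>z\<close> to the density at \<open>x\<close>.\<close>

lemma gaussian_density_change:
  "gaussian_density \<sigma> x * exp (((norm x)\<^sup>2 - (norm z)\<^sup>2) / (2 * \<sigma>\<^sup>2)) = gaussian_density \<sigma> z"
  for x z :: "real^'n"
  unfolding gaussian_density_exp mult.assoc exp_add[symmetric]
  by (simp add: add_divide_distrib[symmetric] flip: diff_divide_distrib)

text \<open>Change of measure: an expectation under the noise becomes a Lebesgue integral, to which
  linear substitution applies.\<close>

lemma nn_integral_exp_noise:
  assumes [measurable]: "T \<in> borel_measurable borel"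
  shows "(\<integral>\<^sup>+\<omega>. exp (((norm (noise \<omega>))\<^sup>2 - (norm (T (noise \<omega>)))\<^sup>2) / (2 * \<sigma>\<^sup>2)) \<partial>P)
    = (\<integral>\<^sup>+x. gaussian_density \<sigma> (T x :: real^'n) \<partial>lborel)"
  using distributed_nn_integral[OF distributed_noise,
      of "\<lambda>x. ennreal (exp (((norm x)\<^sup>2 - (norm (T x))\<^sup>2) / (2 * \<sigma>\<^sup>2)))"]
  by (simp add: ennreal_mult'[symmetric] gaussian_density_change)

text \<open>
  The left-hand side is the Jacobian factor \<open>1 / |det K| = |det L|\<close>; Jensen's inequality applied
  to the reciprocal factor \<open>\<integral> gaussian_density (L x) dx\<close> bounds it by the Frobenius norm of \<open>L\<close>.
\<close>

lemma nn_integral_exp_affine_le: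
  fixes K L :: "real^'n^'n"
  assumes KL: "K ** L = mat 1" and LK: "L ** K = mat 1"
  shows "(\<integral>\<^sup>+\<omega>. exp (((norm (noise \<omega>))\<^sup>2 - (norm (K *v noise \<omega> + c))\<^sup>2) / (2 * \<sigma>\<^sup>2)) \<partial>P)
    \<le> exp (((norm L)\<^sup>2 - CARD('n)) / 2)"
proof -
  let ?p = "\<lambda>x::real^'n. ennreal (gaussian_density \<sigma> x)"
  let ?J = "\<lambda>K. (\<integral>\<^sup>+x. ?p (K *v x) \<partial>lborel)"
  have KLx: "K *v (L *v x) = x" "L *v (K *v x) = x" for x
    by (simp_all add: matrix_vector_mul_assoc KL LK)
  note lin = nn_integral_lborel_linear[OF matrix_vector_mul_linear _ _ _ _ nn_integral_gaussian_density]
  have "(\<integral>\<^sup>+\<omega>. exp (((norm (noise \<omega>))\<^sup>2 - (norm (K *v noise \<omega> + c))\<^sup>2) / (2 * \<sigma>\<^sup>2)) \<partial>P) = (\<integral>\<^sup>+x. ?p (K *v x + c) \<partial>lborel)"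
    by (rule nn_integral_exp_noise) measurable
  \<comment> \<open>Linear substitution splits off the Jacobian factor of \<open>K\<close>; the
    shift by \<open>c\<close> then has no effect.\<close>
  also have "\<dots> = ?J K * (\<integral>\<^sup>+x. ?p (x + c) \<partial>lborel)"
    by (rule lin[where F="\<lambda>x. ?p (x + c)", OF KLx(1)]) (auto simp: gaussian_density_uminus)
  also have "(\<integral>\<^sup>+x. ?p (x + c) \<partial>lborel) = 1"
    using nn_integral_lborel_shift[of ?p c] by (simp add: nn_integral_gaussian_density)
  finally have 1: "(\<integral>\<^sup>+\<omega>. exp (((norm (noise \<omega>))\<^sup>2 - (norm (K *v noise \<omega> + c))\<^sup>2) / (2 * \<sigma>\<^sup>2)) \<partial>P) = ?J K"
    by simp
  \<comment> \<open>Substitution for the composition of \<open>K\<close> and \<open>L\<close>, which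
    is the identity, shows that the two Jacobian factors are reciprocal.\<close>
  have "1 = (\<integral>\<^sup>+x. ?p (K *v (L *v x)) \<partial>lborel)"
    by (simp add: KLx nn_integral_gaussian_density)
  also have "\<dots> = ?J L * ?J K"
    by (rule lin[where F="\<lambda>x. ?p (K *v x)", OF KLx(2)]) (auto simp: gaussian_density_uminus)
  finally have 2: "?J L * ?J K = 1" ..
  \<comment> \<open>\<open>m\<close> is the mean of \<open>D\<close>, the log density ratio
    belonging to \<open>L\<close>.\<close>
  define m where "m = (CARD('n) - (norm L)\<^sup>2) / 2"
  define D where "D \<omega> = ((norm (noise \<omega>))\<^sup>2 - (norm (L *v noise \<omega>))\<^sup>2) / (2 * \<sigma>\<^sup>2)" for \<omega>
  have D: "has_bochner_integral P D m"
  proof -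
    have "has_bochner_integral P D ((\<sigma>\<^sup>2 * (norm (mat 1 :: real^'n^'n))\<^sup>2 - \<sigma>\<^sup>2 * (norm L)\<^sup>2) / (2 * \<sigma>\<^sup>2))"
      unfolding D_def[abs_def]
      using has_bochner_integral_norm_noise_sq[of "mat 1"] has_bochner_integral_norm_noise_sq[of L]
      by (intro has_bochner_integral_divide has_bochner_integral_diff) simp_all
    moreover have "(\<sigma>\<^sup>2 * (norm (mat 1 :: real^'n^'n))\<^sup>2 - \<sigma>\<^sup>2 * (norm L)\<^sup>2) / (2 * \<sigma>\<^sup>2) = m"
      using sigma_pos by (simp add: m_def norm_mat_1 field_simps)
    ultimately show ?thesis by simp
  qed
  \<comment> \<open>Jensen by hand: the tangent line of \<open>exp\<close> at \<open>m\<close> lies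
    below \<open>exp\<close> and has expectation \<open>exp m\<close> along
    \<open>D\<close>.\<close>
  have "has_bochner_integral P (\<lambda>\<omega>. exp m * (1 + D \<omega> - m)) (exp m * (1 + m - m))"
    using D by (simp add: has_bochner_integral_iff prob_space)
  then have "ennreal (exp m) \<le> (\<integral>\<^sup>+\<omega>. ennreal (exp m * (1 + D \<omega> - m)) \<partial>P)"
    using integral_le_nn_integral[of P "\<lambda>\<omega>. exp m * (1 + D \<omega> - m)"] by (simp add: has_bochner_integral_iff)
  also have "\<dots> \<le> (\<integral>\<^sup>+\<omega>. exp (D \<omega>) \<partial>P)"
  proof (intro nn_integral_mono ennreal_leI)
    fix \<omega>
    have "exp m * (1 + (D \<omega> - m)) \<le> exp m * exp (D \<omega> - m)"
      by (intro mult_left_mono exp_ge_add_one_self) auto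
    then show "exp m * (1 + D \<omega> - m) \<le> exp (D \<omega>)"
      by (simp add: exp_diff algebra_simps)
  qed
  also have "\<dots> = ?J L"
    unfolding D_def by (rule nn_integral_exp_noise) measurable
  \<comment> \<open>The lower bound \<open>exp m\<close> for \<open>?J L\<close> becomes the upper
    bound \<open>exp (- m)\<close> for its reciprocal \<open>?J K\<close>.\<close>
  finally have "ennreal (exp m) * ?J K \<le> ?J L * ?J K" by (rule mult_right_mono) simp
  then have "ennreal (exp (- m)) * (ennreal (exp m) * ?J K) \<le> ennreal (exp (- m)) * 1"
    unfolding 2 by (rule mult_left_mono) simp
  also have "ennreal (exp (- m)) * (ennreal (exp m) * ?J K) = ?J K"
    by (simp add: mult.assoc[symmetric] ennreal_mult'[symmetric] exp_minus)
  also have "- m = ((norm L)\<^sup>2 - CARD('n)) / 2" by (simp add: m_def field_simps)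
  finally show ?thesis unfolding 1 by simp
qed

end

section \<open>Exponential moments of the penalized noise\<close>

text \<open>The perturbation uses \<open>g + v\<close> because
  \<open>x \<bullet> (transpose B *v (g + v))\<close> is \<open>(g - v) \<bullet> (g + v)\<close>.
  The resulting negative multiple of the squared norm of \<open>v\<close> pays for the
  \<open>v\<close> part of the squared perturbation, leaving a bound in \<open>x\<close> and
  \<open>g\<close> alone.\<close>

lemma norm_perturbed_sq_le:
  fixes B :: "real^'n^'n" and x v :: "real^'n" and s k :: real
  assumes B: "\<And>x. norm (B *v x) \<le> 2 * norm x" and s: "0 \<le> s" and k: "0 \<le> k" "k \<le> 1/4"
  defines "g \<equiv> B *v x + v"
  shows "(norm (x - s *\<^sub>R g + k *\<^sub>R (transpose B *v (g + v))))\<^sup>2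
    \<le> (norm x)\<^sup>2 - 2 * s * (x \<bullet> g) + (2 * k + 2 * (s + 2 * k)\<^sup>2) * (norm g)\<^sup>2"
proof -
  define w where "w = k *\<^sub>R (transpose B *v (g + v)) - s *\<^sub>R g"
  have "x \<bullet> (transpose B *v (g + v)) = (B *v x) \<bullet> (g + v)"
    by (subst inner_matrix_vector_transpose) simp
  also have "B *v x = g - v"
    by (simp add: g_def)
  also have "(g - v) \<bullet> (g + v) = (norm g)\<^sup>2 - (norm v)\<^sup>2"
    by (simp add: inner_diff_left inner_diff_right inner_add_left inner_add_right power2_norm_eq_inner inner_commute)
  finally have xw: "x \<bullet> w = k * ((norm g)\<^sup>2 - (norm v)\<^sup>2) - s * (x \<bullet> g)"
    unfolding w_def inner_diff_right inner_scaleR_right by simp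
  have "norm w \<le> k * norm (transpose B *v (g + v)) + s * norm g"
    unfolding w_def using s k by (intro order_trans[OF norm_triangle_ineq4]) simp
  also have "\<dots> \<le> k * (2 * (norm g + norm v)) + s * norm g"
    using k norm_transpose_mult_le[OF B, of "g + v"] norm_triangle_ineq[of g v]
    by (intro add_right_mono mult_left_mono) auto
  finally have "norm w \<le> (s + 2 * k) * norm g + 2 * k * norm v"
    by (simp add: algebra_simps)
  then have "(norm w)\<^sup>2 \<le> ((s + 2 * k) * norm g + 2 * k * norm v)\<^sup>2"
    by (intro power_mono) auto
  also have "\<dots> \<le> 2 * ((s + 2 * k) * norm g)\<^sup>2 + 2 * (2 * k * norm v)\<^sup>2"
    by (smt (verit) sum_squares_bound power2_sum)
  also have "\<dots> = 2 * (s + 2 * k)\<^sup>2 * (norm g)\<^sup>2 + (4 * k) * (2 * k * (norm v)\<^sup>2)"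
    by (simp add: power2_eq_square)
  \<comment> \<open>This is where \<open>k \<le> 1/4\<close> enters; the remaining \<open>v\<close>
    term cancels exactly against the one in \<open>xw\<close>.\<close>
  also have "(4 * k) * (2 * k * (norm v)\<^sup>2) \<le> 1 * (2 * k * (norm v)\<^sup>2)"
    using k by (intro mult_right_mono) auto
  finally have ww: "(norm w)\<^sup>2 \<le> 2 * (s + 2 * k)\<^sup>2 * (norm g)\<^sup>2 + 2 * k * (norm v)\<^sup>2"
    by simp
  have "(norm (x + w))\<^sup>2 = (norm x)\<^sup>2 + 2 * (x \<bullet> w) + (norm w)\<^sup>2"
    by (simp add: power2_norm_eq_inner inner_add_left inner_add_right inner_commute)
  also have "\<dots> \<le> (norm x)\<^sup>2 - 2 * s * (x \<bullet> g) + (2 * k + 2 * (s + 2 * k)\<^sup>2) * (norm g)\<^sup>2"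
    using ww unfolding xw by (simp add: algebra_simps)
  finally show ?thesis by (simp add: w_def algebra_simps)
qed

text \<open>
  The factor \<open>s = 1/23\<close> is the \<open>2/46\<close> in front of \<open>\<xi> \<bullet> g\<close>, and \<open>3/529 = 3 s\<^sup>2\<close> is just large enough to absorb
  the quadratic terms of the Neumann series.
\<close>

lemma perturbed_identity_inverse:
  fixes B :: "real^'n^'n"
  assumes B: "\<And>x. norm (B *v x) \<le> 2 * norm x"
  defines "K \<equiv> mat 1 - ((1/23) *\<^sub>R B - (3/529) *\<^sub>R (transpose B ** B))"
  obtains L where "K ** L = mat 1" "L ** K = mat 1" "(norm L)\<^sup>2 \<le> CARD('n) + 2/23 * mat_trace B"
proof -
  let ?X = "(1/23) *\<^sub>R B - (3/529) *\<^sub>R (transpose B ** B)"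
  have BB: "norm (transpose B *v (B *v x)) \<le> 4 * norm x" for x
    using norm_transpose_mult_le[OF B, of "B *v x"] B[of x] by simp
  \<comment> \<open>\<open>58/529\<close> is \<open>2 * 1/23 + 4 * 3/529\<close>.\<close>
  have X: "norm (?X *v x) \<le> 58/529 * norm x" for x
  proof -
    have "?X *v x = (1/23) *\<^sub>R (B *v x) - (3/529) *\<^sub>R (transpose B *v (B *v x))"
      by (simp add: matrix_vector_mult_diff_rdistrib matrix_vector_mul_assoc
          flip: scaleR_matrix_vector_assoc del: transpose_matrix_vector)
    also have "norm \<dots> \<le> 1/23 * norm (B *v x) + 3/529 * norm (transpose B *v (B *v x))"
      by (rule order_trans[OF norm_triangle_ineq4]) simp
    also have "\<dots> \<le> 58/529 * norm x"
      using B[of x] BB[of x] by simp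
    finally show ?thesis .
  qed
  obtain L where L: "K ** L = mat 1" "L ** K = mat 1"
    and nL: "(norm L)\<^sup>2 \<le> CARD('n) + 2 * mat_trace ?X + (2 / (1 - 58/529) + 1 / (1 - 58/529)\<^sup>2) * (norm ?X)\<^sup>2"
    unfolding K_def by (rule mat_1_minus_inverse[OF X]) auto
  have "norm ?X \<le> 1/23 * norm B + 3/529 * norm (transpose B ** B)"
    by (rule order_trans[OF norm_triangle_ineq4]) simp
  \<comment> \<open>In Frobenius norm \<open>transpose B ** B\<close> costs only a factor 2, and
    \<open>1/23 + 2 * 3/529 = 29/529\<close>.\<close>
  also have "\<dots> \<le> 29/529 * norm B"
    using norm_matrix_mult_le[OF norm_transpose_mult_le[OF B], of B] by simp
  finally have "(2 / (1 - 58/529) + 1 / (1 - 58/529)\<^sup>2) * (norm ?X)\<^sup>2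
    \<le> (2 / (1 - 58/529) + 1 / (1 - 58/529)\<^sup>2) * (29/529 * norm B)\<^sup>2"
    by (intro mult_left_mono power_mono) auto
  also have "\<dots> \<le> 6/529 * (norm B)\<^sup>2"
    unfolding power_mult_distrib mult.assoc[symmetric]
    by (intro mult_right_mono) (auto simp: power2_eq_square)
  finally have "(norm L)\<^sup>2 \<le> CARD('n) + 2 * mat_trace ?X + 6/529 * (norm B)\<^sup>2"
    using nL by (meson add_left_mono order_trans)
  \<comment> \<open>Twice the term \<open>- 3/529\<close> cancels the second-order contribution
    \<open>6/529\<close>, so only the trace of \<open>B\<close> remains.\<close>
  moreover have "mat_trace ?X = 1/23 * mat_trace B - 3/529 * (norm B)\<^sup>2"
    using mat_trace_mult[of "transpose B" B]
    by (simp add: mat_trace_eq_inner inner_diff_right power2_norm_eq_inner)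
  ultimately have "(norm L)\<^sup>2 \<le> CARD('n) + 2/23 * mat_trace B"
    by simp
  with L show ?thesis using that by blast
qed

context iid_gaussian
begin

text \<open>The integrand is at most \<open>exp (- mat_trace B / 23)\<close> times a density ratio
  for the affine map with linear part \<open>K\<close>. The expected ratio is at most
  \<open>exp (mat_trace B / 23)\<close> by the bound on \<open>norm L\<close>, so the trace
  correction balances the Jacobian.\<close>

lemma nn_integral_exp_penalized_noise_le_1:
  fixes B :: "real^'n^'n" and v :: "real^'n"
  assumes B: "\<And>x. norm (B *v x) \<le> 2 * norm x"
  defines "g \<equiv> \<lambda>\<omega>. B *v noise \<omega> + v"
  shows "(\<integral>\<^sup>+\<omega>. exp ((2 * (noise \<omega> \<bullet> g \<omega>) - 2 * \<sigma>\<^sup>2 * mat_trace B - (norm (g \<omega>))\<^sup>2 / 2) / (46 * \<sigma>\<^sup>2)) \<partial>P) \<le> 1"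
proof -
  define K where "K = mat 1 - ((1/23) *\<^sub>R B - (3/529) *\<^sub>R (transpose B ** B))"
  \<comment> \<open>The factor \<open>6/529\<close> is \<open>2 * 3/529\<close>, since
    \<open>g \<omega> + v\<close> contains \<open>v\<close> twice.\<close>
  define c where "c = (6/529) *\<^sub>R (transpose B *v v) - (1/23) *\<^sub>R v"
  obtain L where L: "K ** L = mat 1" "L ** K = mat 1" "(norm L)\<^sup>2 \<le> CARD('n) + 2/23 * mat_trace B"
    unfolding K_def using perturbed_identity_inverse[OF B] by blast
  let ?E = "\<lambda>\<omega>. ((norm (noise \<omega>))\<^sup>2 - (norm (K *v noise \<omega> + c))\<^sup>2) / (2 * \<sigma>\<^sup>2)"
  have le: "(2 * (noise \<omega> \<bullet> g \<omega>) - 2 * \<sigma>\<^sup>2 * mat_trace B - (norm (g \<omega>))\<^sup>2 / 2) / (46 * \<sigma>\<^sup>2)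
    \<le> - (1/23 * mat_trace B) + ?E \<omega>" for \<omega>
  proof -
    let ?x = "noise \<omega>"
    have gv: "g \<omega> + v = B *v ?x + 2 *\<^sub>R v"
      by (simp add: g_def scaleR_2)
    have "K *v ?x + c = ?x - (1/23) *\<^sub>R g \<omega> + (3/529) *\<^sub>R (transpose B *v (g \<omega> + v))"
      unfolding K_def c_def gv matrix_vector_right_distrib matrix_vector_mult_scaleR
      by (simp add: g_def matrix_vector_mult_diff_rdistrib matrix_vector_mul_assoc scaleR_add_right
          flip: scaleR_matrix_vector_assoc del: transpose_matrix_vector)
    then have "(norm (K *v ?x + c))\<^sup>2 \<le> (norm ?x)\<^sup>2 - 2 * (1/23) * (?x \<bullet> g \<omega>)
        + (2 * (3/529) + 2 * (1/23 + 2 * (3/529))\<^sup>2) * (norm (g \<omega>))\<^sup>2"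
      using norm_perturbed_sq_le[OF B, of "1/23" "3/529" ?x v] by (simp add: g_def)
    \<comment> \<open>The coefficient of the squared norm of \<open>g\<close> is about 0.0174; the
      penalty term allows \<open>1/46\<close>, about 0.0217.\<close>
    also have "\<dots> \<le> (norm ?x)\<^sup>2 - 2/23 * (?x \<bullet> g \<omega>) + 1/46 * (norm (g \<omega>))\<^sup>2"
      by (intro add_mono mult_right_mono) (auto simp: power2_eq_square)
    finally have "2/23 * (?x \<bullet> g \<omega>) - 1/46 * (norm (g \<omega>))\<^sup>2 \<le> (norm ?x)\<^sup>2 - (norm (K *v ?x + c))\<^sup>2"
      by simp
    then have "(2/23 * (?x \<bullet> g \<omega>) - 1/46 * (norm (g \<omega>))\<^sup>2) / (2 * \<sigma>\<^sup>2) \<le> ?E \<omega>"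
      by (rule divide_right_mono) simp
    moreover have "(2 * (?x \<bullet> g \<omega>) - 2 * \<sigma>\<^sup>2 * mat_trace B - (norm (g \<omega>))\<^sup>2 / 2) / (46 * \<sigma>\<^sup>2)
      = - (1/23 * mat_trace B) + (2/23 * (?x \<bullet> g \<omega>) - 1/46 * (norm (g \<omega>))\<^sup>2) / (2 * \<sigma>\<^sup>2)"
      using sigma_pos by (simp add: field_simps)
    ultimately show ?thesis by linarith
  qed
  have "(\<integral>\<^sup>+\<omega>. exp ((2 * (noise \<omega> \<bullet> g \<omega>) - 2 * \<sigma>\<^sup>2 * mat_trace B - (norm (g \<omega>))\<^sup>2 / 2) / (46 * \<sigma>\<^sup>2)) \<partial>P)
    \<le> (\<integral>\<^sup>+\<omega>. ennreal (exp (- (1/23 * mat_trace B))) * ennreal (exp (?E \<omega>)) \<partial>P)"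
    unfolding ennreal_mult'[symmetric, OF exp_ge_zero] exp_add[symmetric]
    by (intro nn_integral_mono ennreal_leI) (simp only: exp_le_cancel_iff le)
  also have "\<dots> = ennreal (exp (- (1/23 * mat_trace B))) * (\<integral>\<^sup>+\<omega>. ennreal (exp (?E \<omega>)) \<partial>P)"
    by (rule nn_integral_cmult) measurable
  also have "\<dots> \<le> ennreal (exp (- (1/23 * mat_trace B))) * ennreal (exp (((norm L)\<^sup>2 - CARD('n)) / 2))"
    by (intro mult_left_mono nn_integral_exp_affine_le L) simp
  also have "\<dots> \<le> ennreal 1"
    unfolding ennreal_mult'[symmetric, OF exp_ge_zero] exp_add[symmetric]
    using L(3) by (intro ennreal_leI) simp
  finally show ?thesis by simp
qed

end

section \<open>Excess loss of the penalized minimizer\<close>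

lemma mu_mix_eq_sum: "mu_mix A b \<theta> y = (\<Sum>j\<in>UNIV. \<theta> $ j *\<^sub>R mu_j A b j y)"
proof -
  have "(\<Sum>j\<in>J. \<theta> $ j *\<^sub>R A j) *v y = (\<Sum>j\<in>J. \<theta> $ j *\<^sub>R (A j *v y))" for J
    by (induction J rule: infinite_finite_induct)
       (simp_all add: matrix_vector_mult_add_rdistrib scaleR_matrix_vector_assoc)
  then show ?thesis
    by (simp add: mu_mix_def A_mix_def b_mix_def mu_j_def scaleR_add_right sum.distrib)
qed

text \<open>With \<open>c\<close> equal to the weighted mean this is the variance identity, which
  rewrites the penalty and bounds the loss of the aggregate; with \<open>c\<close> a single
  estimator it expands the excess-loss sum.\<close>

lemma sum_simplex_norm_diff_sq:
  fixes \<mu> :: "'m::finite \<Rightarrow> 'v::real_inner"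
  assumes "\<theta> \<in> prob_simplex"
  shows "(\<Sum>j\<in>UNIV. \<theta> $ j * (norm (\<mu> j - c))\<^sup>2)
    = (\<Sum>j\<in>UNIV. \<theta> $ j * (norm (\<mu> j))\<^sup>2) - 2 * ((\<Sum>j\<in>UNIV. \<theta> $ j *\<^sub>R \<mu> j) \<bullet> c) + (norm c)\<^sup>2"
proof -
  have "(\<Sum>j\<in>UNIV. \<theta> $ j * (norm (\<mu> j - c))\<^sup>2)
    = (\<Sum>j\<in>UNIV. \<theta> $ j * (norm (\<mu> j))\<^sup>2 - 2 * (\<theta> $ j * (\<mu> j \<bullet> c)) + \<theta> $ j * (norm c)\<^sup>2)"
    by (intro sum.cong refl)
       (simp add: power2_norm_eq_inner inner_diff_left inner_diff_right inner_commute algebra_simps)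
  also have "\<dots> = (\<Sum>j\<in>UNIV. \<theta> $ j * (norm (\<mu> j))\<^sup>2) - 2 * (\<Sum>j\<in>UNIV. \<theta> $ j * (\<mu> j \<bullet> c))
      + (\<Sum>j\<in>UNIV. \<theta> $ j) * (norm c)\<^sup>2"
    by (simp add: sum.distrib sum_subtractf sum_distrib_left sum_distrib_right)
  finally show ?thesis
    using assms by (simp add: prob_simplex_def inner_sum_left)
qed

text \<open>By the variance identity the penalty is the averaged squared norm minus that of the
  aggregate, so half of it replaces half of the quadratic term of \<open>Cp\<close> by a linear
  one.\<close>

lemma H_pen_simplex:
  assumes "\<theta> \<in> prob_simplex"
  shows "H_pen \<sigma> A b y \<theta> = (norm (\<Sum>j\<in>UNIV. \<theta> $ j *\<^sub>R mu_j A b j y))\<^sup>2 / 2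
    + (\<Sum>j\<in>UNIV. \<theta> $ j * ((norm (mu_j A b j y))\<^sup>2 / 2 - 2 * (y \<bullet> mu_j A b j y) + 2 * \<sigma>\<^sup>2 * mat_trace (A j)))"
proof -
  have "pen A b y \<theta> = (\<Sum>j\<in>UNIV. \<theta> $ j * (norm (mu_j A b j y - mu_mix A b \<theta> y))\<^sup>2)"
    by (simp add: pen_def norm_minus_commute)
  then have "pen A b y \<theta> = (\<Sum>j\<in>UNIV. \<theta> $ j * (norm (mu_j A b j y))\<^sup>2) - (norm (mu_mix A b \<theta> y))\<^sup>2"
    unfolding sum_simplex_norm_diff_sq[OF assms] by (simp add: mu_mix_eq_sum power2_norm_eq_inner)
  moreover have "mat_trace (A_mix A \<theta>) = (\<Sum>j\<in>UNIV. \<theta> $ j * mat_trace (A j))"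
    by (simp add: mat_trace_eq_inner A_mix_def inner_sum_right)
  moreover have "y \<bullet> mu_mix A b \<theta> y = (\<Sum>j\<in>UNIV. \<theta> $ j * (y \<bullet> mu_j A b j y))"
    by (simp add: mu_mix_eq_sum inner_sum_right)
  ultimately show ?thesis
    unfolding H_pen_def Cp_def
    by (simp add: mu_mix_eq_sum algebra_simps sum.distrib sum_subtractf sum_distrib_left)
       (simp add: field_simps flip: sum_divide_distrib)
qed

lemma axis_in_prob_simplex: "axis k 1 \<in> prob_simplex"
  by (auto simp: prob_simplex_def axis_def)

lemma prob_simplex_convex_comb:
  assumes "\<theta> \<in> prob_simplex" "\<eta> \<in> prob_simplex" "0 \<le> t" "t \<le> 1"
  shows "(1 - t) *\<^sub>R \<theta> + t *\<^sub>R \<eta> \<in> prob_simplex"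
  using assms by (auto simp: prob_simplex_def sum.distrib simp flip: sum_distrib_left)

text \<open>Divide by \<open>t\<close> and let \<open>t\<close> tend to 0 from the right.\<close>

lemma nonneg_of_quadratic_nonneg:
  fixes D q :: real
  assumes "\<And>t. 0 < t \<Longrightarrow> t \<le> 1 \<Longrightarrow> 0 \<le> t * D + t\<^sup>2 * q"
  shows "0 \<le> D"
proof (rule tendsto_lowerbound)
  show "((\<lambda>t. D + t * q) \<longlongrightarrow> D) (at_right 0)"
    by (auto intro!: tendsto_eq_intros)
  have "0 \<le> D + t * q" if "0 < t" "t < 1" for t
  proof -
    have "0 \<le> t * (D + t * q)"
      using assms[of t] that by (simp add: power2_eq_square algebra_simps)
    then show ?thesis using that by (simp add: zero_le_mult_iff)
  qed
  then show "\<forall>\<^sub>F t in at_right 0. 0 \<le> D + t * q"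
    by (auto simp: eventually_at_right[of 0 1] intro!: exI[of _ 1])
qed simp

text \<open>The weighted sum on the right equals the excess loss plus the directional derivative of
  \<open>H_pen\<close> from the minimizer towards vertex \<open>k\<close>, which is
  nonnegative.\<close>

lemma H_pen_minimizer_loss_le:
  fixes A :: "'m::finite \<Rightarrow> real^'n^'n"
  assumes \<theta>: "\<theta> \<in> prob_simplex"
    and min: "\<And>\<eta>. \<eta> \<in> prob_simplex \<Longrightarrow> H_pen \<sigma> A b y \<theta> \<le> H_pen \<sigma> A b y \<eta>"
  defines "\<mu> \<equiv> \<lambda>j. mu_j A b j y"
  shows "(norm (mu_mix A b \<theta> y - f))\<^sup>2 \<le> (norm (\<mu> k - f))\<^sup>2
    + (\<Sum>j\<in>UNIV. \<theta> $ j * (2 * ((y - f) \<bullet> (\<mu> j - \<mu> k)) - 2 * \<sigma>\<^sup>2 * mat_trace (A j - A k)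
        - (norm (\<mu> j - \<mu> k))\<^sup>2 / 2))"
proof -
  define m where "m = mu_mix A b \<theta> y"
  have m: "m = (\<Sum>j\<in>UNIV. \<theta> $ j *\<^sub>R \<mu> j)" by (simp add: m_def mu_mix_eq_sum \<mu>_def)
  define l where "l j = (norm (\<mu> j))\<^sup>2 / 2 - 2 * (y \<bullet> \<mu> j) + 2 * \<sigma>\<^sup>2 * mat_trace (A j)" for j
  have H: "H_pen \<sigma> A b y \<eta> = (norm (\<Sum>j\<in>UNIV. \<eta> $ j *\<^sub>R \<mu> j))\<^sup>2 / 2 + (\<Sum>j\<in>UNIV. \<eta> $ j * l j)"
    if "\<eta> \<in> prob_simplex" for \<eta>
    using H_pen_simplex[OF that] by (simp add: l_def \<mu>_def)
  \<comment> \<open>The derivative at \<open>t = 0\<close> of \<open>H_pen\<close> along the segment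
    from \<open>\<theta>\<close> to \<open>axis k 1\<close>.\<close>
  define D where "D = m \<bullet> (\<mu> k - m) + l k - (\<Sum>j\<in>UNIV. \<theta> $ j * l j)"
  have "0 \<le> D"
  proof (rule nonneg_of_quadratic_nonneg)
    fix t :: real assume t: "0 < t" "t \<le> 1"
    let ?\<eta> = "(1 - t) *\<^sub>R \<theta> + t *\<^sub>R axis k 1"
    have \<eta>: "?\<eta> \<in> prob_simplex"
      using t by (intro prob_simplex_convex_comb \<theta> axis_in_prob_simplex) auto
    have "(\<Sum>j\<in>UNIV. ?\<eta> $ j *\<^sub>R \<mu> j) = (\<Sum>j\<in>UNIV. (1 - t) *\<^sub>R (\<theta> $ j *\<^sub>R \<mu> j) + t *\<^sub>R (if j = k then \<mu> j else 0))"
      by (intro sum.cong) (auto simp: axis_def scaleR_add_left)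
    also have "\<dots> = m + t *\<^sub>R (\<mu> k - m)"
      by (simp add: sum.distrib sum_subtractf m scaleR_right_diff_distrib scaleR_left_diff_distrib flip: scaleR_sum_right
          del: scaleR_scaleR)
    finally have 1: "(\<Sum>j\<in>UNIV. ?\<eta> $ j *\<^sub>R \<mu> j) = m + t *\<^sub>R (\<mu> k - m)" .
    have "(\<Sum>j\<in>UNIV. ?\<eta> $ j * l j) = (\<Sum>j\<in>UNIV. (1 - t) * (\<theta> $ j * l j) + t * (if j = k then l j else 0))"
      by (intro sum.cong) (auto simp: axis_def algebra_simps)
    also have "\<dots> = (1 - t) * (\<Sum>j\<in>UNIV. \<theta> $ j * l j) + t * l k"
      by (simp add: sum.distrib flip: sum_distrib_left)
    finally have 2: "(\<Sum>j\<in>UNIV. ?\<eta> $ j * l j) = (1 - t) * (\<Sum>j\<in>UNIV. \<theta> $ j * l j) + t * l k" .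
    have "(norm (m + t *\<^sub>R (\<mu> k - m)))\<^sup>2 = (norm m)\<^sup>2 + 2 * t * (m \<bullet> (\<mu> k - m)) + t\<^sup>2 * (norm (\<mu> k - m))\<^sup>2"
      by (simp only: power2_norm_eq_inner inner_add_left inner_add_right inner_scaleR_left inner_scaleR_right)
         (simp add: inner_commute power2_eq_square algebra_simps)
    then have "H_pen \<sigma> A b y ?\<eta> - H_pen \<sigma> A b y \<theta> = t * D + t\<^sup>2 * ((norm (\<mu> k - m))\<^sup>2 / 2)"
      unfolding H[OF \<eta>] H[OF \<theta>] 1 2 m[symmetric] D_def by (simp add: algebra_simps)
    with min[OF \<eta>] show "0 \<le> t * D + t\<^sup>2 * ((norm (\<mu> k - m))\<^sup>2 / 2)" by simp
  qed
  moreover have "(\<Sum>j\<in>UNIV. \<theta> $ j * (2 * ((y - f) \<bullet> (\<mu> j - \<mu> k)) - 2 * \<sigma>\<^sup>2 * mat_trace (A j - A k)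
        - (norm (\<mu> j - \<mu> k))\<^sup>2 / 2)) = (norm (m - f))\<^sup>2 - (norm (\<mu> k - f))\<^sup>2 + D"
  proof -
    have sum1: "(\<Sum>j\<in>UNIV. \<theta> $ j) = 1" using \<theta> by (simp add: prob_simplex_def)
    let ?N = "\<Sum>j\<in>UNIV. \<theta> $ j * (norm (\<mu> j))\<^sup>2" and ?T = "\<Sum>j\<in>UNIV. \<theta> $ j * mat_trace (A j)"
    have inn: "(\<Sum>j\<in>UNIV. \<theta> $ j * (z \<bullet> \<mu> j)) = z \<bullet> m" for z
      by (simp add: m inner_sum_right)
    have "(\<Sum>j\<in>UNIV. \<theta> $ j * (2 * ((y - f) \<bullet> (\<mu> j - \<mu> k)) - 2 * \<sigma>\<^sup>2 * mat_trace (A j - A k)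
        - (norm (\<mu> j - \<mu> k))\<^sup>2 / 2))
      = (\<Sum>j\<in>UNIV. 2 * (\<theta> $ j * ((y - f) \<bullet> \<mu> j)) - \<theta> $ j * (2 * ((y - f) \<bullet> \<mu> k))
         - 2 * \<sigma>\<^sup>2 * (\<theta> $ j * mat_trace (A j)) + \<theta> $ j * (2 * \<sigma>\<^sup>2 * mat_trace (A k))
         - \<theta> $ j * (norm (\<mu> j - \<mu> k))\<^sup>2 / 2)"
      by (intro sum.cong refl) (simp add: mat_trace_eq_inner inner_diff_right algebra_simps)
    also have "\<dots> = 2 * ((y - f) \<bullet> m) - 2 * ((y - f) \<bullet> \<mu> k)
         - 2 * \<sigma>\<^sup>2 * ?T + 2 * \<sigma>\<^sup>2 * mat_trace (A k) - (\<Sum>j\<in>UNIV. \<theta> $ j * (norm (\<mu> j - \<mu> k))\<^sup>2) / 2"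
      by (simp only: sum.distrib sum_subtractf sum_distrib_left[symmetric] sum_distrib_right[symmetric]
          sum_divide_distrib[symmetric] sum1 inn mult_1)
    also have "\<dots> = 2 * ((y - f) \<bullet> m) - 2 * ((y - f) \<bullet> \<mu> k)
         - 2 * \<sigma>\<^sup>2 * ?T + 2 * \<sigma>\<^sup>2 * mat_trace (A k) - (?N - 2 * (m \<bullet> \<mu> k) + (norm (\<mu> k))\<^sup>2) / 2"
      unfolding sum_simplex_norm_diff_sq[OF \<theta>] m ..
    also have "\<dots> = (norm (m - f))\<^sup>2 - (norm (\<mu> k - f))\<^sup>2 + D"
    proof -
      have "(\<Sum>j\<in>UNIV. \<theta> $ j * l j)
        = (\<Sum>j\<in>UNIV. \<theta> $ j * (norm (\<mu> j))\<^sup>2 / 2 - 2 * (\<theta> $ j * (y \<bullet> \<mu> j)) + 2 * \<sigma>\<^sup>2 * (\<theta> $ j * mat_trace (A j)))"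
        by (intro sum.cong refl) (simp add: l_def algebra_simps)
      also have "\<dots> = ?N / 2 - 2 * (y \<bullet> m) + 2 * \<sigma>\<^sup>2 * ?T"
        by (simp only: sum.distrib sum_subtractf sum_distrib_left[symmetric] sum_divide_distrib[symmetric] inn)
      finally have "(\<Sum>j\<in>UNIV. \<theta> $ j * l j) = ?N / 2 - 2 * (y \<bullet> m) + 2 * \<sigma>\<^sup>2 * ?T" .
      moreover have "(norm (m - f))\<^sup>2 = (norm m)\<^sup>2 - 2 * (f \<bullet> m) + (norm f)\<^sup>2"
        "(norm (\<mu> k - f))\<^sup>2 = (norm (\<mu> k))\<^sup>2 - 2 * (f \<bullet> \<mu> k) + (norm f)\<^sup>2"
        by (simp_all add: power2_norm_eq_inner inner_diff_left inner_diff_right inner_commute)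
      ultimately show ?thesis
        unfolding D_def l_def
        by (simp add: inner_diff_left inner_diff_right power2_norm_eq_inner[of m] field_simps)
    qed
    finally show ?thesis .
  qed
  ultimately show ?thesis by (simp add: m_def)
qed

text \<open>A weighted average does not exceed the maximum, and the maximum is attained.\<close>

lemma simplex_mean_le:
  fixes z :: "'m::finite \<Rightarrow> real"
  assumes "\<theta> \<in> prob_simplex"
  shows "\<exists>j. (\<Sum>j\<in>UNIV. \<theta> $ j * z j) \<le> z j"
proof -
  have "(\<Sum>j\<in>UNIV. \<theta> $ j * z j) \<le> (\<Sum>j\<in>UNIV. \<theta> $ j * Max (range z))"
    using assms by (intro sum_mono mult_left_mono) (auto simp: prob_simplex_def)
  also have "\<dots> = Max (range z)"
    using assms by (simp add: prob_simplex_def flip: sum_distrib_right)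
  finally show ?thesis
    using Max_in[of "range z"] by (metis finite UNIV_not_empty finite_imageI image_is_empty rangeE)
qed

theorem theorem2p1:
  fixes P :: "'a measure"
    and \<xi> :: "'n::finite \<Rightarrow> 'a \<Rightarrow> real"
    and f :: "real ^ 'n"
    and \<sigma> :: real
    and A :: "'m::finite \<Rightarrow> real ^ 'n ^ 'n"
    and b :: "'m \<Rightarrow> real ^ 'n"
    and \<theta>hat :: "'a \<Rightarrow> real ^ 'm"
    and y :: "'a \<Rightarrow> real ^ 'n"
  assumes M2: "CARD('m) \<ge> 2"
    and P: "prob_space P"
    and sigma_pos: "\<sigma> > 0"
    and indep: "prob_space.indep_vars P (\<lambda>_. borel) \<xi> UNIV"
    and gauss: "\<And>i. distributed P lborel (\<xi> i) (normal_density 0 \<sigma>)"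
    and y_def: "\<And>\<omega>. y \<omega> = f + (\<chi> i. \<xi> i \<omega>)"
    and opnorm: "\<And>j. onorm (\<lambda>v. A j *v v) \<le> 1"
    and \<theta>hat_meas: "\<theta>hat \<in> borel_measurable P"
    and \<theta>hat_simplex: "\<And>\<omega>. \<omega> \<in> space P \<Longrightarrow> \<theta>hat \<omega> \<in> prob_simplex"
    and \<theta>hat_min: "\<And>\<omega> \<theta>. \<omega> \<in> space P \<Longrightarrow> \<theta> \<in> prob_simplex \<Longrightarrow>
                      H_pen \<sigma> A b (y \<omega>) (\<theta>hat \<omega>) \<le> H_pen \<sigma> A b (y \<omega>) \<theta>"
  shows "(\<forall>x>0. measure P {\<omega> \<in> space P.
              (norm (mu_mix A b (\<theta>hat \<omega>) (y \<omega>) - f))\<^sup>2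
                \<le> Min (range (\<lambda>j. (norm (mu_j A b j (y \<omega>) - f))\<^sup>2))
                  + 46 * \<sigma>\<^sup>2 * (2 * ln (real CARD('m)) + x)}
            \<ge> 1 - 2 * exp (- x))
      \<and> integrable P (\<lambda>\<omega>. (norm (mu_mix A b (\<theta>hat \<omega>) (y \<omega>) - f))\<^sup>2)
      \<and> integrable P (\<lambda>\<omega>. Min (range (\<lambda>j. (norm (mu_j A b j (y \<omega>) - f))\<^sup>2)))
      \<and> (\<integral>\<omega>. (norm (mu_mix A b (\<theta>hat \<omega>) (y \<omega>) - f))\<^sup>2 \<partial>P)
          \<le> (\<integral>\<omega>. Min (range (\<lambda>j. (norm (mu_j A b j (y \<omega>) - f))\<^sup>2)) \<partial>P)
             + 92 * \<sigma>\<^sup>2 * ln (exp 1 * real CARD('m))"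
proof -
  interpret iid_gaussian P \<xi> \<sigma>
    using P sigma_pos indep gauss by (simp add: iid_gaussian_def iid_gaussian_axioms_def)
  let ?M = "real CARD('m)" and ?C = "46 * \<sigma>\<^sup>2"
  let ?loss = "\<lambda>\<omega>. (norm (mu_mix A b (\<theta>hat \<omega>) (y \<omega>) - f))\<^sup>2"
  let ?risk = "\<lambda>j \<omega>. (norm (mu_j A b j (y \<omega>) - f))\<^sup>2"
  let ?best = "\<lambda>\<omega>. Min (range (\<lambda>j. ?risk j \<omega>))"
  have C: "0 < ?C" using sigma_pos by simp
  have M: "0 < ?M" by simp
  have y: "y \<omega> = f + noise \<omega>" for \<omega>
    by (simp add: y_def noise_def)
  have y_meas [measurable]: "y \<in> borel_measurable P"
    unfolding y[abs_def] by measurable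
  have mu_meas [measurable]: "(\<lambda>\<omega>. mu_j A b j (y \<omega>)) \<in> borel_measurable P" for j
    unfolding mu_j_def by measurable
  have [measurable]: "(\<lambda>\<omega>. \<theta>hat \<omega> $ j) \<in> borel_measurable P" for j
    using \<theta>hat_meas by (rule borel_measurable_continuous_on[rotated]) (intro continuous_intros)
  have loss_meas [measurable]: "?loss \<in> borel_measurable P"
    unfolding mu_mix_eq_sum by measurable
  have best_meas [measurable]: "?best \<in> borel_measurable P"
    by (rule borel_measurable_Min) auto

  \<comment> \<open>Exponential moments of the pairwise comparisons\<close>
  define Z where "Z j k \<omega> = 2 * (noise \<omega> \<bullet> (mu_j A b j (y \<omega>) - mu_j A b k (y \<omega>)))
      - 2 * \<sigma>\<^sup>2 * mat_trace (A j - A k) - (norm (mu_j A b j (y \<omega>) - mu_j A b k (y \<omega>)))\<^sup>2 / 2" for j k \<omega>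
  \<comment> \<open>Summing over all ordered pairs makes up for the dependence of \<open>j\<close>
    and \<open>k\<close> on the outcome; the number of pairs produces the \<open>2 * ln\<close>
    term.\<close>
  define S where "S \<omega> = (\<Sum>j\<in>UNIV. \<Sum>k\<in>UNIV. exp (Z j k \<omega> / ?C))" for \<omega>
  have [measurable]: "Z j k \<in> borel_measurable P" for j k
    unfolding Z_def[abs_def] by measurable
  have S_meas [measurable]: "S \<in> borel_measurable P"
    unfolding S_def[abs_def] by measurable
  have S_nonneg: "0 \<le> S \<omega>" for \<omega>
    by (auto simp: S_def intro!: sum_nonneg)

  have A1: "norm (A j *v x) \<le> norm x" for j x
  proof -
    have "norm (A j *v x) \<le> onorm (\<lambda>v. A j *v v) * norm x"
      by (rule onorm[OF matrix_vector_mul_bounded_linear])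
    also have "\<dots> \<le> 1 * norm x" by (intro mult_right_mono opnorm) simp
    finally show ?thesis by simp
  qed
  have Z_mgf: "(\<integral>\<^sup>+\<omega>. exp (Z j k \<omega> / ?C) \<partial>P) \<le> 1" for j k
  proof -
    have "norm ((A j - A k) *v x) \<le> 2 * norm x" for x
      using norm_triangle_ineq4[of "A j *v x" "A k *v x"] A1[of j x] A1[of k x]
      by (simp add: matrix_vector_mult_diff_rdistrib)
    moreover have "mu_j A b j (y \<omega>) - mu_j A b k (y \<omega>)
      = (A j - A k) *v noise \<omega> + ((A j - A k) *v f + (b j - b k))" for \<omega>
      by (simp add: mu_j_def y matrix_vector_mult_diff_rdistrib matrix_vector_right_distrib)
    ultimately show ?thesis
      unfolding Z_def using nn_integral_exp_penalized_noise_le_1[of "A j - A k"] by simp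
  qed
  have "ennreal (S \<omega>) = (\<Sum>j\<in>UNIV. \<Sum>k\<in>UNIV. ennreal (exp (Z j k \<omega> / ?C)))" for \<omega>
    by (simp add: S_def sum_nonneg)
  then have "(\<integral>\<^sup>+\<omega>. S \<omega> \<partial>P) = (\<Sum>j\<in>UNIV. \<Sum>k\<in>UNIV. (\<integral>\<^sup>+\<omega>. exp (Z j k \<omega> / ?C) \<partial>P))"
    by (simp add: nn_integral_sum del: sum_ennreal)
  also have "\<dots> \<le> (\<Sum>j\<in>(UNIV::'m set). \<Sum>k\<in>(UNIV::'m set). 1)"
    by (intro sum_mono Z_mgf)
  also have "\<dots> = ennreal (?M\<^sup>2)"
    by (simp add: power2_eq_square ennreal_mult ennreal_of_nat_eq_real_of_nat)
  finally have S_nn: "(\<integral>\<^sup>+\<omega>. S \<omega> \<partial>P) \<le> ennreal (?M\<^sup>2)" .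
  have S_int: "integrable P S"
    using S_nn S_nonneg by (intro integrableI_nonneg) (auto simp: le_less_trans[OF _ ennreal_less_top])
  have S_exp: "expectation S \<le> ?M\<^sup>2"
    using S_nn S_nonneg by (subst (asm) nn_integral_eq_integral[OF S_int]) auto

  \<comment> \<open>Pointwise bound on the excess loss\<close>
  have key: "exp ((?loss \<omega> - ?best \<omega>) / ?C) \<le> S \<omega>" if \<omega>: "\<omega> \<in> space P" for \<omega>
  proof -
    have "?best \<omega> \<in> range (\<lambda>j. ?risk j \<omega>)"
      by (rule Min_in) auto
    \<comment> \<open>Both \<open>k\<close>, the best estimator, and the \<open>j\<close> chosen
      below may vary with \<open>\<omega>\<close>.\<close>
    then obtain k where k: "?best \<omega> = ?risk k \<omega>" by blast
    have "?loss \<omega> \<le> ?risk k \<omega> + (\<Sum>j\<in>UNIV. \<theta>hat \<omega> $ j * Z j k \<omega>)"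
      using H_pen_minimizer_loss_le[OF \<theta>hat_simplex[OF \<omega>] \<theta>hat_min[OF \<omega>], of f k]
      by (simp add: Z_def y)
    moreover obtain j where "(\<Sum>j\<in>UNIV. \<theta>hat \<omega> $ j * Z j k \<omega>) \<le> Z j k \<omega>"
      using simplex_mean_le[OF \<theta>hat_simplex[OF \<omega>], of "\<lambda>j. Z j k \<omega>"] by blast
    ultimately have "?loss \<omega> - ?best \<omega> \<le> Z j k \<omega>" unfolding k by linarith
    then have "exp ((?loss \<omega> - ?best \<omega>) / ?C) \<le> exp (Z j k \<omega> / ?C)"
      using C by (simp add: divide_right_mono)
    also have "\<dots> \<le> (\<Sum>k\<in>UNIV. exp (Z j k \<omega> / ?C))"
      by (rule member_le_sum) auto
    also have "\<dots> \<le> S \<omega>"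
      unfolding S_def by (rule member_le_sum[where f="\<lambda>j. \<Sum>k\<in>UNIV. exp (Z j k \<omega> / ?C)"]) (auto intro!: sum_nonneg)
    finally show ?thesis .
  qed

  \<comment> \<open>Deviation bound by Markov's inequality\<close>
  have "1 - 2 * exp (- x) \<le> prob {\<omega> \<in> space P. ?loss \<omega> \<le> ?best \<omega> + ?C * (2 * ln ?M + x)}" for x
  proof -
    let ?t = "2 * ln ?M + x"
    have "space P - {\<omega> \<in> space P. ?loss \<omega> \<le> ?best \<omega> + ?C * ?t} \<subseteq> {\<omega> \<in> space P. exp ?t \<le> S \<omega>}"
    proof safe
      fix \<omega> assume \<omega>: "\<omega> \<in> space P" and "\<not> ?loss \<omega> \<le> ?best \<omega> + ?C * ?t"
      then have "?t \<le> (?loss \<omega> - ?best \<omega>) / ?C"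
        using C by (simp add: pos_le_divide_eq mult.commute)
      then have "exp ?t \<le> exp ((?loss \<omega> - ?best \<omega>) / ?C)"
        by (simp only: exp_le_cancel_iff)
      also note key[OF \<omega>]
      finally show "exp ?t \<le> S \<omega>" .
    qed
    then have "prob (space P - {\<omega> \<in> space P. ?loss \<omega> \<le> ?best \<omega> + ?C * ?t}) \<le> prob {\<omega> \<in> space P. exp ?t \<le> S \<omega>}"
      by (intro finite_measure_mono) auto
    also have "\<dots> \<le> expectation S / exp ?t"
      by (intro integral_Markov_inequality_measure[OF S_int]) (auto simp: S_nonneg)
    also have "\<dots> \<le> ?M\<^sup>2 / exp ?t"
      by (intro divide_right_mono S_exp) simp
    \<comment> \<open>The term \<open>2 * ln ?M\<close> in the threshold cancels the number of pairs
      and leaves the tail \<open>exp (- x)\<close>.\<close>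
    also have "exp ?t = ?M\<^sup>2 * exp x"
      using M by (simp add: exp_add exp_double)
    also have "?M\<^sup>2 / (?M\<^sup>2 * exp x) = exp (- x)"
      using M by (simp add: exp_minus field_simps)
    finally have "prob (space P - {\<omega> \<in> space P. ?loss \<omega> \<le> ?best \<omega> + ?C * ?t}) \<le> exp (- x)" .
    then show ?thesis
      using exp_gt_zero[of "- x"] by (subst (asm) prob_compl) (auto simp del: exp_gt_zero)
  qed

  \<comment> \<open>Integrability of the losses\<close>
  moreover have risk_int: "integrable P (?risk j)" for j
  proof -
    let ?c = "A j *v f + b j - f"
    have "integrable P (\<lambda>\<omega>. 2 * (norm (A j *v noise \<omega>))\<^sup>2 + 2 * (norm ?c)\<^sup>2)"
      using has_bochner_integral_norm_noise_sq[of "A j"] by (auto simp: has_bochner_integral_iff)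
    then show ?thesis
    proof (rule Bochner_Integration.integrable_bound)
      have "?risk j \<omega> \<le> 2 * (norm (A j *v noise \<omega>))\<^sup>2 + 2 * (norm ?c)\<^sup>2" for \<omega>
      proof -
        have "mu_j A b j (y \<omega>) - f = A j *v noise \<omega> + ?c"
          by (simp add: mu_j_def y matrix_vector_right_distrib)
        then have "?risk j \<omega> \<le> (norm (A j *v noise \<omega>) + norm ?c)\<^sup>2"
          using norm_triangle_ineq[of "A j *v noise \<omega>" ?c] by (intro power_mono) (simp_all only: norm_ge_zero)
        also have "\<dots> \<le> 2 * (norm (A j *v noise \<omega>))\<^sup>2 + 2 * (norm ?c)\<^sup>2"
          by (smt (verit) sum_squares_bound power2_sum)
        finally show ?thesis .
      qed
      then show "AE \<omega> in P. norm (?risk j \<omega>) \<le> norm (2 * (norm (A j *v noise \<omega>))\<^sup>2 + 2 * (norm ?c)\<^sup>2)"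
        by simp
    qed measurable
  qed
  have loss_int: "integrable P ?loss"
  proof (rule Bochner_Integration.integrable_bound)
    show "integrable P (\<lambda>\<omega>. \<Sum>j\<in>UNIV. ?risk j \<omega>)"
      by (intro Bochner_Integration.integrable_sum risk_int)
    have "?loss \<omega> \<le> (\<Sum>j\<in>UNIV. ?risk j \<omega>)" if \<omega>: "\<omega> \<in> space P" for \<omega>
    proof -
      note \<theta> = \<theta>hat_simplex[OF \<omega>]
      let ?m = "\<Sum>j\<in>UNIV. \<theta>hat \<omega> $ j *\<^sub>R (mu_j A b j (y \<omega>) - f)"
      have "?m = mu_mix A b (\<theta>hat \<omega>) (y \<omega>) - f"
        using \<theta> by (simp add: mu_mix_eq_sum prob_simplex_def scaleR_diff_right sum_subtractf flip: scaleR_left.sum)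
      \<comment> \<open>Nonnegative variance gives convexity: the loss of the aggregate is at most
        the average loss.\<close>
      moreover have "0 \<le> (\<Sum>j\<in>UNIV. \<theta>hat \<omega> $ j * (norm (mu_j A b j (y \<omega>) - f - ?m))\<^sup>2)"
        using \<theta> by (intro sum_nonneg mult_nonneg_nonneg) (auto simp: prob_simplex_def)
      ultimately have "?loss \<omega> \<le> (\<Sum>j\<in>UNIV. \<theta>hat \<omega> $ j * ?risk j \<omega>)"
        using sum_simplex_norm_diff_sq[OF \<theta>, of "\<lambda>j. mu_j A b j (y \<omega>) - f" ?m]
        by (simp add: power2_norm_eq_inner)
      also have "\<dots> \<le> (\<Sum>j\<in>UNIV. 1 * ?risk j \<omega>)"
      proof (intro sum_mono mult_right_mono)
        fix j
        have "\<theta>hat \<omega> $ j \<le> (\<Sum>j\<in>UNIV. \<theta>hat \<omega> $ j)"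
          using \<theta> by (intro member_le_sum) (auto simp: prob_simplex_def)
        then show "\<theta>hat \<omega> $ j \<le> 1" using \<theta> by (simp add: prob_simplex_def)
      qed simp
      finally show ?thesis by simp
    qed
    then show "AE \<omega> in P. norm (?loss \<omega>) \<le> norm (\<Sum>j\<in>UNIV. ?risk j \<omega>)"
      by (auto simp: sum_nonneg)
  qed measurable
  have best_int: "integrable P ?best"
  proof (rule Bochner_Integration.integrable_bound[OF risk_int])
    have "0 \<le> ?best \<omega>" for \<omega> by (subst Min_ge_iff) auto
    moreover have "?best \<omega> \<le> ?risk j \<omega>" for \<omega> j by (rule Min_le) auto
    \<comment> \<open>\<open>undefined\<close> stands for an arbitrary index; any single loss
      dominates the minimum.\<close>
    ultimately show "AE \<omega> in P. norm (?best \<omega>) \<le> norm (?risk undefined \<omega>)" by simp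
  qed measurable

  \<comment> \<open>Bound in expectation\<close>
  have "expectation ?loss \<le> expectation ?best + 92 * \<sigma>\<^sup>2 * ln (exp 1 * ?M)"
  proof -
    let ?D = "\<lambda>\<omega>. (?loss \<omega> - ?best \<omega>) / ?C"
    let ?a = "2 * ln ?M"
    have "expectation ?D \<le> expectation (\<lambda>\<omega>. ?a - 1 + S \<omega> / ?M\<^sup>2)"
    proof (rule integral_mono)
      show "integrable P ?D" "integrable P (\<lambda>\<omega>. ?a - 1 + S \<omega> / ?M\<^sup>2)"
        using loss_int best_int S_int by auto
      fix \<omega> assume \<omega>: "\<omega> \<in> space P"
      \<comment> \<open>Centering at \<open>?a\<close> makes the exponential at most
        \<open>S \<omega> / ?M\<^sup>2\<close>, whose mean is at most 1 and so offsets the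
        \<open>- 1\<close>.\<close>
      have "1 + (?D \<omega> - ?a) \<le> exp (?D \<omega> - ?a)" by (rule exp_ge_add_one_self)
      also have "\<dots> = exp (?D \<omega>) / ?M\<^sup>2"
        using M by (simp add: exp_diff exp_double)
      also have "\<dots> \<le> S \<omega> / ?M\<^sup>2"
        by (intro divide_right_mono key \<omega>) simp
      finally show "?D \<omega> \<le> ?a - 1 + S \<omega> / ?M\<^sup>2" by linarith
    qed
    also have "\<dots> = ?a - 1 + expectation S / ?M\<^sup>2"
      using S_int by (simp add: prob_space)
    also have "\<dots> \<le> ?a"
      using S_exp M by simp
    also have "expectation ?D = (expectation ?loss - expectation ?best) / ?C"
      using loss_int best_int by simp
    finally have "expectation ?loss - expectation ?best \<le> ?a * ?C"
      using C by (simp only: pos_divide_le_eq)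
    \<comment> \<open>The left side is \<open>92 * \<sigma>\<^sup>2 * ln ?M\<close>; the factor
      \<open>exp 1\<close> inside the logarithm only adds slack.\<close>
    also have "\<dots> \<le> 92 * \<sigma>\<^sup>2 * ln (exp 1 * ?M)"
      using M sigma_pos by (simp add: ln_mult algebra_simps)
    finally show ?thesis by simp
  qed
  ultimately show ?thesis
    using loss_int best_int by blast
qed

end
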